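(* Let $n\ge 2$ be an integer and let $P: v_1v_2\ldots v_{2n+1}$ be a path with $2n+1$ vertices. Let $a$ and $b$ be positive real numbers such that $2b>3a$ and $2a>b>a$. Define a weight function $w$ on $V(P)$ by $$w(v_j)=\begin{cases} b & \text{if } j\in\{1,2\},\\ 2^{i-1}a & \text{if } j\ge 3 \text{ and } j\in\{2i,2i+1\}\text{ for some } i\in\{1,\ldots,n\}.\end{cases}$$ Then $S=\{v_2,v_4,\ldots,v_{2n}\}$ is the unique minimum safe set of $(P,w)$.
   Context: For a graph $G$ and $S\subset V(G)$, $G[S]$ is the subgraph induced by $S$ and $G-S=G[V(G)\setminus S]$. "Component" means connected component (often identified with its vertex set). A weight function $w$ on $V(G)$ assigns a positive real number to each vertex, and for $X\subset V(G)$, $w(X)=\sum_{v\in X}w(v)$. For disjoint $A,B\subset V(G)$, $E(A,B)$ is the set of edges joining a vertex of $A$ to a vertex of $B$. For a connected graph $G$ with weight function $w$, a non-empty subset $S\subset V(G)$ is a (weighted) safe set of $(G,w)$ if for every component $C$ of $G[S]$ and every component $D$ of $G-S$, $w(C)\ge w(D)$ whenever $E(C,D)\neq\emptyset$. A minimum safe set is a safe set $S$ whose weight $w(S)$ is minimum among all safe sets of $(G,w)$. *)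

theory Defs
  imports Complex_Main "Graph_Theory.Graph_Theory"
begin

text \<open>
  Following the AFP entry Graph_Theory, an undirected simple graph is a finite symmetric digraph
  without loops and parallel arcs (locale \<^locale>\<open>graph\<close>); an undirected edge is a pair of
  opposite arcs.
\<close>

text \<open>
  Vertex sets of the connected components. In a symmetric digraph, the strongly connected
  components are the connected components of the undirected graph.
\<close>
definition comp_verts :: "('a, 'b) pre_digraph \<Rightarrow> 'a set set" where
  "comp_verts G = pre_digraph.sccs_verts G"

text \<open>
  For disjoint \<open>A\<close> and \<open>B\<close>, an undirected edge between \<open>A\<close> and \<open>B\<close> is represented here by
  exactly one ordered pair, namely the one whose first entry lies in \<open>A\<close>.
\<close>
definition edges_between :: "('a, 'b) pre_digraph \<Rightarrow> 'a set \<Rightarrow> 'a set \<Rightarrow> ('a \<times> 'a) set" where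
  "edges_between G A B = {(u, v). u \<in> A \<and> v \<in> B \<and> u \<rightarrow>\<^bsub>G\<^esub> v}"

text \<open>
  Intended for \<open>G\<close> a connected \<^locale>\<open>graph\<close> and \<open>w\<close> positive on its vertices.
\<close>
definition safe_set :: "('a, 'b) pre_digraph \<Rightarrow> ('a \<Rightarrow> real) \<Rightarrow> 'a set \<Rightarrow> bool" where
  "safe_set G w S \<longleftrightarrow> S \<noteq> {} \<and> S \<subseteq> verts G \<and>
     (\<forall>C \<in> comp_verts (G \<restriction> S). \<forall>D \<in> comp_verts (G \<restriction> (verts G - S)).
        edges_between G C D \<noteq> {} \<longrightarrow> sum w C \<ge> sum w D)"

definition minimum_safe_set :: "('a, 'b) pre_digraph \<Rightarrow> ('a \<Rightarrow> real) \<Rightarrow> 'a set \<Rightarrow> bool" where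
  "minimum_safe_set G w S \<longleftrightarrow>
     safe_set G w S \<and> (\<forall>T. safe_set G w T \<longrightarrow> sum w S \<le> sum w T)"

text \<open>
  The path \<open>v 1, v 2, \<dots>, v m\<close>; only meant for \<open>v\<close> injective on \<open>{1..m}\<close>.
\<close>
definition path_graph :: "(nat \<Rightarrow> 'a) \<Rightarrow> nat \<Rightarrow> ('a, 'a \<times> 'a) pre_digraph" where
  "path_graph v m = with_proj
     \<lparr> pverts = v ` {1..m},
       parcs = {(v i, v j) | i j. i \<in> {1..m} \<and> j \<in> {1..m} \<and> (j = i + 1 \<or> i = j + 1)} \<rparr>"

lemma path_graph_simps:
  "verts (path_graph v m) = v ` {1..m}"
  "arcs (path_graph v m) =
     {(v i, v j) | i j. i \<in> {1..m} \<and> j \<in> {1..m} \<and> (j = i + 1 \<or> i = j + 1)}"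
  "arcs_ends (path_graph v m) = arcs (path_graph v m)"
  "tail (path_graph v m) = fst"
  "head (path_graph v m) = snd"
  by (simp_all only: path_graph_def with_proj_simps pair_pre_digraph.select_convs)

lemma wf_digraph_path_graph: "wf_digraph (path_graph v m)"
proof
  fix e assume "e \<in> arcs (path_graph v m)"
  then obtain i j where "e = (v i, v j)" "i \<in> {1..m}" "j \<in> {1..m}"
    unfolding path_graph_simps by blast
  then show "tail (path_graph v m) e \<in> verts (path_graph v m)"
    and "head (path_graph v m) e \<in> verts (path_graph v m)"
    by (simp_all only: path_graph_simps fst_conv snd_conv imageI)
qed

lemma graph_path_graph:
  assumes inj: "inj_on v {1..m}"
  shows "graph (path_graph v m)"
proof -
  interpret wf_digraph "path_graph v m"
    by (rule wf_digraph_path_graph)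
  show ?thesis
  proof
    show "finite (verts (path_graph v m))"
      unfolding path_graph_simps by simp
    have "arcs (path_graph v m) \<subseteq> v ` {1..m} \<times> v ` {1..m}"
      unfolding path_graph_simps by blast
    then show "finite (arcs (path_graph v m))"
      by (rule finite_subset) simp
    show "tail (path_graph v m) e \<noteq> head (path_graph v m) e"
      if "e \<in> arcs (path_graph v m)" for e
    proof -
      from that obtain i j where ij: "e = (v i, v j)" "i \<in> {1..m}" "j \<in> {1..m}"
        and "j = i + 1 \<or> i = j + 1"
        unfolding path_graph_simps by blast
      then have "i \<noteq> j"
        by linarith
      with ij show ?thesis
        unfolding path_graph_simps by (simp add: inj_on_eq_iff[OF inj])
    qed
    show "e1 = e2"
      if "arc_to_ends (path_graph v m) e1 = arc_to_ends (path_graph v m) e2" for e1 e2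
      using that by (simp add: arc_to_ends_def path_graph_simps prod_eq_iff)
    show "symmetric (path_graph v m)"
      unfolding symmetric_def path_graph_simps by (rule symI) blast
  qed
qed

lemma connected_path_graph:
  assumes m: "1 \<le> m"
  shows "Digraph_Component.connected (path_graph v m)"
proof -
  let ?G = "path_graph v m"
  interpret wf_digraph ?G
    by (rule wf_digraph_path_graph)
  have reach: "v 1 \<rightarrow>\<^sup>*\<^bsub>?G\<^esub> v i \<and> v i \<rightarrow>\<^sup>*\<^bsub>?G\<^esub> v 1" if "1 \<le> i" "i \<le> m" for i
    using that
  proof (induction i rule: dec_induct)
    case base
    have "v 1 \<in> verts ?G"
      unfolding path_graph_simps using m by (intro imageI) simp
    then show ?case
      by (intro conjI reachable_refl)
  next
    case (step k)
    then have k: "k \<in> {1..m}" "Suc k \<in> {1..m}"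
      by auto
    then have "v k \<rightarrow>\<^bsub>?G\<^esub> v (Suc k)" "v (Suc k) \<rightarrow>\<^bsub>?G\<^esub> v k"
      unfolding path_graph_simps Suc_eq_plus1 by blast+
    moreover have "v 1 \<rightarrow>\<^sup>*\<^bsub>?G\<^esub> v k" "v k \<rightarrow>\<^sup>*\<^bsub>?G\<^esub> v 1"
      using step k by simp_all
    ultimately show ?case
      using reachable_trans reachable_adjI by blast
  qed
  have "x \<rightarrow>\<^sup>*\<^bsub>?G\<^esub> y" if xy: "x \<in> verts ?G" "y \<in> verts ?G" for x y
  proof -
    from xy obtain i j where "x = v i" "y = v j" "i \<in> {1..m}" "j \<in> {1..m}"
      unfolding path_graph_simps by blast
    then show ?thesis
      using reach[of i] reach[of j] reachable_trans[of x "v 1" y] by simp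
  qed
  then have "x \<rightarrow>\<^sup>*\<^bsub>mk_symmetric ?G\<^esub> y" if "x \<in> verts ?G" "y \<in> verts ?G" for x y
    using that by (intro reachable_mk_symmetricI)
  moreover have "v ` {1..m} \<noteq> {}"
    using m by simp
  ultimately show ?thesis
    unfolding Digraph_Component.connected_def strongly_connected_def
    by (simp add: mk_symmetric_def path_graph_simps(1))
qed

end

theory Submission
  imports Defs
begin

text \<open>
  Safety of a set of path vertices depends only on its set \<open>I\<close> of indices: the components of both
  induced subgraphs are maximal intervals, and two of them are joined by an edge exactly when they
  are consecutive (\<open>safe_set_path_iff\<close>).

  The even indices form a safe set because every component, of the set and of its complement, is a
  single vertex, and each vertex of even index is at least as heavy as its two neighbours. Their
  weight up to index \<open>2 * k + 1\<close> is \<open>budget k = b + (2 ^ k - 2) * a\<close>, and since \<open>b < 2 * a\<close> this is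
  less than the weight of the pair \<open>{2 * k, 2 * k + 1}\<close> alone, about half of the weight up to
  \<open>2 * k + 1\<close>.

  Conversely, let \<open>I\<close> be safe and at most as heavy as the even indices. Descending from \<open>k = n\<close> to
  \<open>k = 1\<close>, keep the invariant that the part of \<open>I\<close> up to \<open>2 * k + 1\<close> weighs at most \<open>budget k\<close>.
  Then \<open>I\<close> contains \<open>2 * k\<close> and not \<open>2 * k + 1\<close> (\<open>budget_forces_even\<close>): otherwise either \<open>I\<close>
  contains both, or the gap of \<open>I\<close> around \<open>2 * k\<close> has to be dominated by the run of \<open>I\<close> on its left,
  and each of these puts at least the weight of the pair into \<open>I\<close>. If there is no run on the left,
  the gap reaches back to index 1; then it contains both vertices of weight \<open>b\<close>, and \<open>2 * b > 3 * a\<close>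
  makes it heavier than the run on its right. Removing \<open>2 * k\<close> turns \<open>budget k\<close> into
  \<open>budget (k - 1)\<close>, so the descent goes on; at its end only index 1 is undecided, and there
  is no weight left for it.
\<close>

section \<open>Runs of index sets and components of induced subgraphs of a path\<close>

text \<open>
  The interval \<open>{i..j}\<close> is a maximal one inside \<open>I\<close>. The sets of interest do not contain 0, so for
  them \<open>i \<ge> 1\<close> and the truncated \<open>i - 1\<close> is the true left neighbour of the interval.
\<close>

definition run :: "nat set \<Rightarrow> nat \<Rightarrow> nat \<Rightarrow> bool" where
  "run I i j \<longleftrightarrow> i \<le> j \<and> {i..j} \<subseteq> I \<and> i - 1 \<notin> I \<and> Suc j \<notin> I"

lemma run_around:
  assumes "finite I" "0 \<notin> I" "k \<in> I"
  obtains i j where "run I i j" "i \<le> k" "k \<le> j"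
proof -
  define i where "i = (LEAST i. {i..k} \<subseteq> I)"
  have "{k..k} \<subseteq> I" using assms by simp
  then have i: "{i..k} \<subseteq> I" "i \<le> k"
    unfolding i_def by (rule LeastI, rule Least_le)
  have "i \<noteq> 0"
    using i assms(2) by (metis atLeastAtMost_iff le0 subsetD)
  have "i - 1 \<notin> I"
  proof
    assume "i - 1 \<in> I"
    have "{i - 1..k} \<subseteq> insert (i - 1) {i..k}" by auto
    then have "{i - 1..k} \<subseteq> I" using i \<open>i - 1 \<in> I\<close> by blast
    then have "i \<le> i - 1" unfolding i_def by (rule Least_le)
    then show False using \<open>i \<noteq> 0\<close> by simp
  qed
  define N where "N = Suc (Max I)"
  have N: "x < N" if "x \<in> I" for x
    using that assms unfolding N_def by (simp add: le_imp_less_Suc)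
  define s where "s = (LEAST s. k < s \<and> s \<notin> I)"
  have ex: "k < N \<and> N \<notin> I" using N assms by blast
  then have s: "k < s" "s \<notin> I"
    unfolding s_def using LeastI[of "\<lambda>s. k < s \<and> s \<notin> I" N] by blast+
  have s_min: "x \<in> I" if "k < x" "x < s" for x
    using not_less_Least[of x "\<lambda>s. k < s \<and> s \<notin> I"] that unfolding s_def by blast
  have "{i..s - 1} \<subseteq> I"
  proof
    fix x assume "x \<in> {i..s - 1}"
    then show "x \<in> I" using i s s_min by (cases "x \<le> k") auto
  qed
  then have "run I i (s - 1)"
    unfolding run_def using \<open>i - 1 \<notin> I\<close> s i by auto
  then show ?thesis using that i s by auto
qed

lemma adj_path:
  "x \<rightarrow>\<^bsub>path_graph v m\<^esub> y \<longleftrightarrow>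
    (\<exists>i\<in>{1..m}. \<exists>j\<in>{1..m}. x = v i \<and> y = v j \<and> (j = i + 1 \<or> i = j + 1))"
  unfolding path_graph_simps by blast

lemma adj_induced_path:
  "x \<rightarrow>\<^bsub>path_graph v m \<restriction> X\<^esub> y \<longleftrightarrow>
    x \<in> X \<and> y \<in> X \<and> (\<exists>i\<in>{1..m}. \<exists>j\<in>{1..m}. x = v i \<and> y = v j \<and> (j = i + 1 \<or> i = j + 1))"
proof -
  have "x \<rightarrow>\<^bsub>path_graph v m \<restriction> X\<^esub> y \<longleftrightarrow> x \<in> X \<and> y \<in> X \<and> x \<rightarrow>\<^bsub>path_graph v m\<^esub> y"
    unfolding path_graph_simps(3) by (force simp: arcs_ends_conv path_graph_simps(4,5))
  then show ?thesis unfolding adj_path .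
qed

lemma reachable_within_run:
  assumes "I \<subseteq> {1..m}" "run I i j" "x \<in> {i..j}" "y \<in> {i..j}"
  shows "v x \<rightarrow>\<^sup>*\<^bsub>path_graph v m \<restriction> v ` I\<^esub> v y"
proof -
  let ?H = "path_graph v m \<restriction> v ` I"
  interpret wf_digraph ?H
    by (rule wf_digraph.wellformed_induce_subgraph[OF wf_digraph_path_graph])
  have "v i \<rightarrow>\<^sup>*\<^bsub>?H\<^esub> v k \<and> v k \<rightarrow>\<^sup>*\<^bsub>?H\<^esub> v i" if "i \<le> k" "k \<le> j" for k
    using that
  proof (induction k rule: dec_induct)
    case base
    have "i \<in> I" using assms(2) by (auto simp: run_def)
    then show ?case by (intro conjI reachable_refl) simp_all
  next
    case (step k)
    then have "k \<in> I" "Suc k \<in> I" using assms(2) by (auto simp: run_def)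
    then have "v k \<rightarrow>\<^bsub>?H\<^esub> v (Suc k)" "v (Suc k) \<rightarrow>\<^bsub>?H\<^esub> v k"
      unfolding adj_induced_path using assms(1) by (metis Suc_eq_plus1 imageI subsetD)+
    then show ?case
      using step reachable_trans reachable_adjI by (metis Suc_leD)
  qed
  from this[of x] this[of y] show ?thesis
    using assms reachable_trans by (meson atLeastAtMost_iff)
qed

text \<open>
  An arc of the path changes the index by one, so a walk could leave a run only through \<open>i - 1\<close> or
  \<open>Suc j\<close>, and neither lies in \<open>I\<close>.
\<close>

lemma reachable_stays_in_run:
  assumes "inj_on v {1..m}" "I \<subseteq> {1..m}" "run I i j"
    and "x \<rightarrow>\<^sup>*\<^bsub>path_graph v m \<restriction> v ` I\<^esub> y" and "x \<in> v ` {i..j}"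
  shows "y \<in> v ` {i..j}"
proof -
  let ?H = "path_graph v m \<restriction> v ` I"
  interpret wf_digraph ?H
    by (rule wf_digraph.wellformed_induce_subgraph[OF wf_digraph_path_graph])
  show ?thesis
    using assms(4)
  proof (induction rule: reachable_induct)
    case base
    show ?case by (rule assms(5))
  next
    case (step y z)
    then obtain p q k where p: "y = v p" "p \<in> {1..m}" and q: "z = v q" "q \<in> {1..m}"
      and pq: "q = p + 1 \<or> p = q + 1" and k: "y = v k" "k \<in> {i..j}"
      and z: "z \<in> v ` I"
      unfolding adj_induced_path by blast
    have ij: "{i..j} \<subseteq> I" using assms(3) by (simp add: run_def)
    then have "k = p"
      using p k assms(1,2) by (metis inj_onD subsetD)
    obtain t where t: "z = v t" "t \<in> I" using z by blast
    then have "t \<in> {1..m}" using assms(2) by blast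
    with t q have "q = t" using inj_onD[OF assms(1)] by simp
    then have "q \<in> I" using t(2) by simp
    have "q \<in> {i..j}"
    proof (rule ccontr)
      assume "q \<notin> {i..j}"
      then have "q = Suc j \<or> q = i - 1"
        using pq k(2) \<open>k = p\<close> by auto
      then show False
        using \<open>q \<in> I\<close> assms(3) by (auto simp: run_def)
    qed
    then show ?case using q by blast
  qed
qed

lemma comp_verts_induced_path:
  assumes inj: "inj_on v {1..m}" and I: "I \<subseteq> {1..m}"
  shows "comp_verts (path_graph v m \<restriction> v ` I) = {v ` {i..j} | i j. run I i j}"
    (is "?L = ?R")
proof -
  let ?H = "path_graph v m \<restriction> v ` I"
  interpret wf_digraph ?H
    by (rule wf_digraph.wellformed_induce_subgraph[OF wf_digraph_path_graph])
  have conv: "C \<in> ?L \<longleftrightarrow> C \<noteq> {} \<and> (\<forall>x\<in>C. \<forall>y\<in>C. x \<rightarrow>\<^sup>*\<^bsub>?H\<^esub> y) \<and>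
      (\<forall>x\<in>C. \<forall>y. y \<notin> C \<longrightarrow> \<not> x \<rightarrow>\<^sup>*\<^bsub>?H\<^esub> y \<or> \<not> y \<rightarrow>\<^sup>*\<^bsub>?H\<^esub> x)" for C
    unfolding comp_verts_def pre_digraph.sccs_verts_def by simp
  have sub: "v ` {i..j} \<in> ?L" if r: "run I i j" for i j
    unfolding conv
  proof (intro conjI ballI allI impI)
    show "v ` {i..j} \<noteq> {}" using r by (simp add: run_def)
  next
    fix x y assume "x \<in> v ` {i..j}" "y \<in> v ` {i..j}"
    then show "x \<rightarrow>\<^sup>*\<^bsub>?H\<^esub> y" using reachable_within_run[OF I r] by blast
  next
    fix x y assume "x \<in> v ` {i..j}" "y \<notin> v ` {i..j}"
    then show "\<not> x \<rightarrow>\<^sup>*\<^bsub>?H\<^esub> y \<or> \<not> y \<rightarrow>\<^sup>*\<^bsub>?H\<^esub> x"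
      using reachable_stays_in_run[OF inj I r] by blast
  qed
  have "C \<in> ?R" if C: "C \<in> ?L" for C
  proof -
    obtain x where x: "x \<in> C" using C unfolding conv by blast
    then have "x \<rightarrow>\<^sup>*\<^bsub>?H\<^esub> x" using C unfolding conv by simp
    then have "x \<in> v ` I"
      using reachable_in_verts(1) by fastforce
    then obtain k where k: "k \<in> I" "x = v k" by blast
    have "finite I" "0 \<notin> I" using I finite_subset by auto
    then obtain i j where r: "run I i j" "i \<le> k" "k \<le> j"
      using run_around k by metis
    then have "x \<in> v ` {i..j}" using k by simp
    \<comment> \<open>Two components that share a vertex coincide.\<close>
    then have "C = v ` {i..j}"
      using x C sub[OF r(1)] unfolding conv by blast
    then show ?thesis using r by blast
  qed
  then show ?thesis using sub by blast
qed

text \<open>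
  Safety of a set of indices of the path on \<open>{1..m}\<close>, apart from non-emptiness: \<open>f\<close> gives the weight
  of each index, and a run and a gap are compared when they are consecutive.
\<close>

definition path_safe :: "(nat \<Rightarrow> real) \<Rightarrow> nat \<Rightarrow> nat set \<Rightarrow> bool" where
  "path_safe f m I \<longleftrightarrow>
    (\<forall>i j k l. run I i j \<longrightarrow> run ({1..m} - I) k l \<longrightarrow> k = Suc j \<or> i = Suc l \<longrightarrow>
      sum f {k..l} \<le> sum f {i..j})"

lemma path_safeD:
  assumes "path_safe f m I" "run I i j" "run ({1..m} - I) k l" "k = Suc j \<or> i = Suc l"
  shows "sum f {k..l} \<le> sum f {i..j}"
  using assms unfolding path_safe_def by blast

lemma edges_between_runs:
  assumes inj: "inj_on v {1..m}" and I: "I \<subseteq> {1..m}"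
    and r: "run I i j" "run ({1..m} - I) k l"
  shows "edges_between (path_graph v m) (v ` {i..j}) (v ` {k..l}) \<noteq> {} \<longleftrightarrow>
    k = Suc j \<or> i = Suc l"
proof
  have sub: "{i..j} \<subseteq> I" "{k..l} \<subseteq> {1..m} - I" "i \<le> j" "k \<le> l"
    using r by (auto simp: run_def)
  {
    assume "edges_between (path_graph v m) (v ` {i..j}) (v ` {k..l}) \<noteq> {}"
    then obtain x y where e: "x \<in> {i..j}" "y \<in> {k..l}" "v x \<rightarrow>\<^bsub>path_graph v m\<^esub> v y"
      unfolding edges_between_def by blast
    then obtain p q where xy: "x \<in> {i..j}" "y \<in> {k..l}" "p \<in> {1..m}" "q \<in> {1..m}"
      "v x = v p" "v y = v q" and pq: "q = p + 1 \<or> p = q + 1"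
      unfolding adj_path by blast
    have "x \<in> {1..m}" "y \<in> {1..m}" using xy sub I by blast+
    then have "x = p" "y = q" using xy inj by (auto dest: inj_onD)
    then have yx: "y = Suc x \<or> x = Suc y" using pq by auto
    have ni: "y \<notin> {i..j}" using xy(2) sub by blast
    have nk: "x \<notin> {k..l}" using xy(1) sub by blast
    show "k = Suc j \<or> i = Suc l"
      using yx ni nk xy(1,2) by auto
  }
  assume "k = Suc j \<or> i = Suc l"
  then obtain x y where xy: "x \<in> {i..j}" "y \<in> {k..l}" "y = x + 1 \<or> x = y + 1"
    using sub(3,4) by (metis Suc_eq_plus1 atLeastAtMost_iff order_refl)
  then have "v x \<rightarrow>\<^bsub>path_graph v m\<^esub> v y"
    unfolding adj_path using sub I by blast
  then show "edges_between (path_graph v m) (v ` {i..j}) (v ` {k..l}) \<noteq> {}"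
    unfolding edges_between_def using xy by blast
qed

lemma safe_set_path_iff:
  assumes inj: "inj_on v {1..m}" and I: "I \<subseteq> {1..m}"
    and w: "\<And>j. j \<in> {1..m} \<Longrightarrow> w (v j) = f j"
  shows "safe_set (path_graph v m) w (v ` I) \<longleftrightarrow> I \<noteq> {} \<and> path_safe f m I"
proof -
  let ?J = "{1..m} - I"
  have compl: "verts (path_graph v m) - v ` I = v ` ?J"
    unfolding path_graph_simps using inj_on_image_set_diff[OF inj, of "{1..m}" I] I by auto
  have sum: "sum w (v ` {i..j}) = sum f {i..j}" if "{i..j} \<subseteq> {1..m}" for i j
  proof -
    have "inj_on v {i..j}" using inj that by (rule inj_on_subset)
    then show ?thesis using that w by (auto simp: sum.reindex intro!: sum.cong)
  qed
  have sumI: "sum w (v ` {i..j}) = sum f {i..j}" if "run I i j" for i j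
    using that I by (intro sum) (meson run_def subset_trans)
  have sumJ: "sum w (v ` {i..j}) = sum f {i..j}" if "run ?J i j" for i j
    using that by (intro sum) (meson run_def subset_trans Diff_subset)
  have "(\<forall>C\<in>comp_verts (path_graph v m \<restriction> v ` I). \<forall>D\<in>comp_verts (path_graph v m \<restriction> v ` ?J).
        edges_between (path_graph v m) C D \<noteq> {} \<longrightarrow> sum w D \<le> sum w C) \<longleftrightarrow>
     (\<forall>i j k l. run I i j \<longrightarrow> run ?J k l \<longrightarrow>
        edges_between (path_graph v m) (v ` {i..j}) (v ` {k..l}) \<noteq> {} \<longrightarrow>
        sum w (v ` {k..l}) \<le> sum w (v ` {i..j}))"
    unfolding comp_verts_induced_path[OF inj I] comp_verts_induced_path[OF inj Diff_subset]
    by blast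
  also have "\<dots> \<longleftrightarrow> path_safe f m I"
    unfolding path_safe_def using edges_between_runs[OF inj I] sumI sumJ by metis
  finally show ?thesis
    unfolding safe_set_def compl using I by (auto simp: path_graph_simps)
qed

section \<open>The doubling weights and the safe set of even indices\<close>

locale doubling_weights =
  fixes a b :: real
  assumes a_pos: "a > 0" and a_less_b: "a < b" and b_large: "3 * a < 2 * b" and b_less: "b < 2 * a"
begin

definition weight :: "nat \<Rightarrow> real" where
  "weight j = (if j \<le> 2 then b else 2 ^ (j div 2 - 1) * a)"

text \<open>
  The weight of the even indices up to \<open>2 * k\<close>, for \<open>k \<ge> 1\<close> (see \<open>sum_weight_evens\<close>).
\<close>

definition budget :: "nat \<Rightarrow> real" where
  "budget k = b + (2 ^ k - 2) * a"

lemma weight_pos: "weight j > 0"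
  using a_pos a_less_b by (auto simp: weight_def)

lemma weight_odd: "1 \<le> k \<Longrightarrow> weight (2 * k + 1) = 2 ^ (k - 1) * a"
  by (simp add: weight_def)

lemma weight_even: "2 \<le> k \<Longrightarrow> weight (2 * k) = 2 ^ (k - 1) * a"
  by (simp add: weight_def)

lemma weight_1_2: "weight 1 = b" "weight 2 = b"
  by (simp_all add: weight_def)

lemma budget_Suc: "budget (Suc k) = budget k + weight (2 * Suc k)" if "1 \<le> k"
  using that weight_even[of "Suc k"] by (simp add: budget_def algebra_simps)

text \<open>
  The pair weighs \<open>2 ^ k * a\<close> for \<open>k \<ge> 2\<close>, which exceeds the budget by \<open>2 * a - b\<close>; for \<open>k = 1\<close> it
  weighs \<open>b + a\<close>, while the budget is \<open>b\<close>.
\<close>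

lemma budget_less_pair: "budget k < weight (2 * k) + weight (2 * k + 1)" if "1 \<le> k"
proof (cases "k = 1")
  case True
  then show ?thesis using weight_odd[of 1] weight_1_2 a_pos by (simp add: budget_def)
next
  case False
  have pow: "2 ^ k = 2 * (2::real) ^ (k - 1)" using that by (cases k) auto
  have "weight (2 * k) + weight (2 * k + 1) = 2 ^ k * a"
    unfolding pow using weight_odd[of k] weight_even[of k] that False by simp
  moreover have "budget k = b - 2 * a + 2 ^ k * a" by (simp add: budget_def algebra_simps)
  ultimately show ?thesis using b_less by simp
qed

lemma sum_weight_prefix: "1 \<le> k \<Longrightarrow> sum weight {1..2 * k + 1} = 2 * b + (2 ^ (k + 1) - 3) * a"
proof (induction k rule: dec_induct)
  case base
  have "{1..2 * 1 + 1} = {1, 2, 3::nat}" by auto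
  then show ?case using weight_odd[of 1] weight_1_2 by simp
next
  case (step k)
  have "{1..2 * Suc k + 1} = insert (2 * Suc k) (insert (2 * Suc k + 1) {1..2 * k + 1})"
    by auto
  then have "sum weight {1..2 * Suc k + 1} =
      weight (2 * Suc k) + (weight (2 * Suc k + 1) + sum weight {1..2 * k + 1})"
    by simp
  then show ?case
    using step weight_odd[of "Suc k"] weight_even[of "Suc k"] by (simp add: algebra_simps)
qed

lemma sum_weight_evens:
  assumes "1 \<le> n"
  shows "sum weight ((*) 2 ` {1..n}) = budget n"
proof -
  have "(\<Sum>i\<in>{1..n}. weight (2 * i)) = budget n"
    using assms
  proof (induction n rule: dec_induct)
    case base
    show ?case using weight_1_2 by (simp add: budget_def)
  next
    case (step k)
    then show ?case using budget_Suc[of k] by simp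
  qed
  then show ?thesis by (simp add: sum.reindex inj_on_def)
qed

lemma weight_odd_le_even:
  assumes "1 \<le> i" "j = 2 * i - 1 \<or> j = 2 * i + 1"
  shows "weight j \<le> weight (2 * i)"
  using assms(2)
proof
  assume j: "j = 2 * i + 1"
  then show ?thesis
    using assms weight_odd[of i] weight_even[of i] weight_1_2 a_less_b by (cases "i = 1") auto
next
  assume j: "j = 2 * i - 1"
  show ?thesis
  proof (cases "i = 1")
    case True
    then show ?thesis using j weight_1_2 by simp
  next
    case False
    then obtain l where l: "i = Suc l" "1 \<le> l" using assms(1) by (cases i) auto
    then have "weight j = 2 ^ (l - 1) * a" using j weight_odd[of l] by simp
    also have "\<dots> \<le> 2 ^ l * a" using a_pos by (intro mult_right_mono power_increasing) auto
    also have "\<dots> = weight (2 * i)" using l weight_even[of i] by simp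
    finally show ?thesis .
  qed
qed

lemma path_safe_evens: "path_safe weight (2 * n + 1) ((*) 2 ` {1..n})" (is "path_safe _ _ ?E")
  unfolding path_safe_def
proof (intro allI impI)
  fix i j k l
  assume r: "run ?E i j" "run ({1..2 * n + 1} - ?E) k l" and adj: "k = Suc j \<or> i = Suc l"
  have E: "x \<in> ?E \<longleftrightarrow> x \<in> {1..2 * n + 1} \<and> even x" for x by (auto elim!: evenE)
  have ij: "x \<in> ?E" if "i \<le> x" "x \<le> j" for x using that r(1) by (auto simp: run_def)
  have kl: "x \<in> {1..2 * n + 1} - ?E" if "k \<le> x" "x \<le> l" for x
    using that r(2) unfolding run_def by (meson atLeastAtMost_iff subsetD)
  have "i \<le> j" "k \<le> l" using r by (auto simp: run_def)
  have "i = j" using ij[of i] ij[of "Suc i"] \<open>i \<le> j\<close> unfolding E by (cases "i = j") auto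
  have "k = l" using kl[of k] kl[of "Suc k"] \<open>k \<le> l\<close> unfolding E Diff_iff by (cases "k = l") auto
  obtain t where "i = 2 * t" "1 \<le> t" using ij[of i] \<open>i \<le> j\<close> by auto
  then show "sum weight {k..l} \<le> sum weight {i..j}"
    using weight_odd_le_even[of t k] adj \<open>i = j\<close> \<open>k = l\<close> by auto
qed

section \<open>Light safe sets\<close>

text \<open>
  The step of the descent. The assumption \<open>right\<close> records what the earlier steps decided about the
  next pair: it bounds the run of \<open>I\<close> to the right of \<open>2 * k\<close>, which cannot go beyond \<open>2 * k + 2\<close>.
\<close>

lemma budget_forces_even:
  assumes k: "1 \<le> k" "k \<le> n"
    and I: "I \<subseteq> {1..2 * n + 1}" "I \<noteq> {}" and safe: "path_safe weight (2 * n + 1) I"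
    and right: "k < n \<Longrightarrow> 2 * k + 2 \<in> I \<and> 2 * k + 3 \<notin> I"
    and light: "sum weight (I \<inter> {1..2 * k + 1}) \<le> budget k"
  shows "2 * k \<in> I" "2 * k + 1 \<notin> I"
proof -
  let ?J = "{1..2 * n + 1} - I"
  let ?P = "I \<inter> {1..2 * k + 1}"
  have finI: "finite I" "0 \<notin> I" using I finite_subset by auto
  have below: "sum weight X < weight (2 * k) + weight (2 * k + 1)" if "X \<subseteq> ?P" for X
  proof -
    have "sum weight X \<le> sum weight ?P"
      using that weight_pos by (intro sum_mono2) (auto intro: less_imp_le)
    then show ?thesis using light budget_less_pair[OF k(1)] by linarith
  qed
  have pair: "sum weight {2 * k, 2 * k + 1} = weight (2 * k) + weight (2 * k + 1)" by simp
  show even_in: "2 * k \<in> I"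
  proof (rule ccontr)
    assume ni: "2 * k \<notin> I"
    then have "2 * k \<in> ?J" using k by auto
    then obtain p q where pq: "run ?J p q" "p \<le> 2 * k" "2 * k \<le> q"
      using run_around[of ?J "2 * k"] by auto
    have inJ: "x \<in> ?J" if "p \<le> x" "x \<le> q" for x using that pq(1) by (auto simp: run_def)
    have "q \<le> 2 * k + 1"
    proof (rule ccontr)
      assume "\<not> q \<le> 2 * k + 1"
      then have "2 * k + 2 \<in> ?J" using pq(2) by (intro inJ) auto
      then show False using right k(2) by (cases "k = n") auto
    qed
    then have q: "q = 2 * k \<and> 2 * k + 1 \<in> I \<or> q = 2 * k + 1 \<and> 2 * k + 1 \<notin> I"
    proof (cases "q = 2 * k")
      case True
      then have "2 * k + 1 \<notin> ?J" using pq(1) unfolding run_def by simp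
      then have "2 * k + 1 \<in> I" using k by simp
      then show ?thesis using True by blast
    next
      case False
      then have "q = 2 * k + 1" using \<open>q \<le> 2 * k + 1\<close> pq(3) by simp
      then show ?thesis using inJ[of q] pq(2) by simp
    qed
    show False
    proof (cases "p = 1")
      \<comment> \<open>The gap has a run of \<open>I\<close> on its left, at least as heavy. Together with \<open>2 * k + 1\<close>, if that
        lies in \<open>I\<close>, this run weighs at least as much as the whole pair.\<close>
      case False
      then have "p - 1 \<in> I" using pq(1) inJ[of p] pq(2,3) by (auto simp: run_def)
      then obtain r s where rs: "run I r s" "r \<le> p - 1" "p - 1 \<le> s"
        using run_around finI by metis
      have inI: "x \<in> I" if "r \<le> x" "x \<le> s" for x using that rs(1) by (auto simp: run_def)
      have "p \<notin> I" "p \<noteq> 0" using inJ[of p] pq by auto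
      then have "\<not> p \<le> s" using inI[of p] order_trans[OF rs(2) diff_le_self] by blast
      then have p: "p = Suc s" using rs(3) by linarith
      then have le: "sum weight {p..q} \<le> sum weight {r..s}"
        using path_safeD[OF safe rs(1) pq(1)] by blast
      have subP: "{r..s} \<subseteq> ?P"
      proof
        fix x assume x: "x \<in> {r..s}"
        then have "x \<in> I" using inI by simp
        moreover have "x \<le> 2 * k" using x p pq(2) by simp
        ultimately show "x \<in> ?P" using I by auto
      qed
      show False
        using q
      proof
        assume "q = 2 * k \<and> 2 * k + 1 \<in> I"
        moreover have "weight (2 * k) \<le> sum weight {p..q}"
          using pq weight_pos by (intro member_le_sum) (auto intro: less_imp_le)
        moreover have "2 * k + 1 \<notin> {r..s}" using p pq by auto
        ultimately show False
          using below[of "insert (2 * k + 1) {r..s}"] subP le by auto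
      next
        assume "q = 2 * k + 1 \<and> 2 * k + 1 \<notin> I"
        then have "sum weight {2 * k, 2 * k + 1} \<le> sum weight {p..q}"
          using pq weight_pos by (intro sum_mono2) (auto intro: less_imp_le)
        then show False using below[OF subP] le pair by linarith
      qed
    next
      \<comment> \<open>The gap reaches back to index 1, and only the run on its right can dominate it.\<close>
      case True
      have half: "2 ^ k * a = 2 * (2 ^ (k - 1) * a)" using k(1) by (cases k) auto
      have prefix: "sum weight {1..2 * k + 1} = 2 * b - 3 * a + 2 * (2 ^ k * a)"
        unfolding sum_weight_prefix[OF k(1)] by (simp add: algebra_simps)
      have up: "weight (2 * k + 2) = 2 ^ k * a" using weight_even[of "k + 1"] k by simp
      show False
        using q
      proof
        \<comment> \<open>The run is contained in \<open>{2 * k + 1, 2 * k + 2}\<close> and weighs at most \<open>3 * 2 ^ (k - 1) * a\<close>,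
          while the gap weighs \<open>2 * b - 3 * a\<close> more than that.\<close>
        assume q: "q = 2 * k \<and> 2 * k + 1 \<in> I"
        then obtain r s where rs: "run I r s" "r \<le> 2 * k + 1" "2 * k + 1 \<le> s"
          using run_around finI by metis
        have inI: "x \<in> I" if "r \<le> x" "x \<le> s" for x using that rs(1) by (auto simp: run_def)
        have r: "r = 2 * k + 1" using inI[of "2 * k"] ni rs by linarith
        have "s \<le> 2 * k + 2"
        proof (rule ccontr)
          assume "\<not> s \<le> 2 * k + 2"
          then have "2 * k + 3 \<in> I" using inI r by simp
          then show False
            using right k(2) subsetD[OF I(1), of "2 * k + 3"] by (cases "k = n") auto
        qed
        then have "{r..s} \<subseteq> {2 * k + 1, 2 * k + 2}" using r by auto
        then have "sum weight {r..s} \<le> sum weight {2 * k + 1, 2 * k + 2}"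
          using weight_pos by (intro sum_mono2) (auto intro: less_imp_le)
        also have "\<dots> = 2 ^ (k - 1) * a + 2 ^ k * a" using weight_odd[OF k(1)] up by simp
        finally have "sum weight {r..s} \<le> 2 ^ (k - 1) * a + 2 ^ k * a" .
        moreover have "sum weight {1..2 * k} \<le> sum weight {r..s}"
          using path_safeD[OF safe rs(1) pq(1)] q r True by simp
        moreover have "sum weight {1..2 * k + 1} = sum weight {1..2 * k} + 2 ^ (k - 1) * a"
          using weight_odd[OF k(1)] by simp
        ultimately show False using prefix half b_large by linarith
      next
        \<comment> \<open>Now the run is the single vertex \<open>2 * k + 2\<close>, weighing no more than the pair inside the gap.\<close>
        assume q: "q = 2 * k + 1 \<and> 2 * k + 1 \<notin> I"
        have "k < n"
        proof (rule ccontr)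
          assume "\<not> k < n"
          then have "{1..2 * n + 1} \<subseteq> {p..q}" using q True k by simp
          then have "I = {}" using inJ I(1) by auto
          then show False using I by simp
        qed
        then obtain r s where rs: "run I r s" "r \<le> 2 * k + 2" "2 * k + 2 \<le> s"
          using run_around finI right by metis
        have inI: "x \<in> I" if "r \<le> x" "x \<le> s" for x using that rs(1) by (auto simp: run_def)
        have r: "r = 2 * k + 2" using inI[of "2 * k + 1"] q rs by linarith
        have s: "s = 2 * k + 2" using inI[of "2 * k + 3"] right[OF \<open>k < n\<close>] rs by linarith
        have "sum weight {1..2 * k + 1} \<le> sum weight {r..s}"
          using path_safeD[OF safe rs(1) pq(1)] q r True by simp
        then have "2 * b - 3 * a + 2 * (2 ^ k * a) \<le> 2 ^ k * a"
          using prefix r s up by simp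
        moreover have "0 < 2 ^ k * a" using a_pos by simp
        ultimately show False using b_large by linarith
      qed
    qed
  qed
  show "2 * k + 1 \<notin> I"
  proof
    assume "2 * k + 1 \<in> I"
    then have "{2 * k, 2 * k + 1} \<subseteq> ?P" using even_in k by auto
    from below[OF this] show False using pair by simp
  qed
qed

text \<open>
  Once the descent has placed index 2 in \<open>I\<close>, index 1 is excluded because \<open>{1, 2}\<close> weighs \<open>2 * b\<close>
  and \<open>budget 1 = b\<close>.
\<close>

lemma light_safe_eq_evens:
  assumes n: "1 \<le> n" and I: "I \<subseteq> {1..2 * n + 1}" "I \<noteq> {}"
    and safe: "path_safe weight (2 * n + 1) I" and light: "sum weight I \<le> budget n"
  shows "I = (*) 2 ` {1..n}"
proof -
  have desc: "sum weight (I \<inter> {1..2 * k + 1}) \<le> budget k \<and>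
      (k < n \<longrightarrow> 2 * k + 2 \<in> I \<and> 2 * k + 3 \<notin> I)" if "1 \<le> k" "k \<le> n" for k
    using that(2,1)
  proof (induction k rule: inc_induct)
    case base
    have "I \<inter> {1..2 * n + 1} = I" using I by blast
    then show ?case using light by simp
  next
    case (step k)
    then have IH: "sum weight (I \<inter> {1..2 * Suc k + 1}) \<le> budget (Suc k)"
      "Suc k < n \<longrightarrow> 2 * Suc k + 2 \<in> I \<and> 2 * Suc k + 3 \<notin> I"
      by simp_all
    have "Suc k \<le> n" using step by simp
    then have pair: "2 * Suc k \<in> I" "2 * Suc k + 1 \<notin> I"
      using budget_forces_even[of "Suc k" n I] IH I safe by auto
    have "I \<inter> {1..2 * Suc k + 1} = insert (2 * Suc k) (I \<inter> {1..2 * k + 1})"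
      using pair by (auto simp: le_Suc_eq)
    then have "sum weight (I \<inter> {1..2 * k + 1}) \<le> budget k"
      using IH(1) budget_Suc[of k] step by simp
    then show ?case using pair by (simp add: numeral_3_eq_3)
  qed
  have pair: "2 * k \<in> I" "2 * k + 1 \<notin> I" if "1 \<le> k" "k \<le> n" for k
    using budget_forces_even[OF that I safe] desc[OF that] by auto
  have "1 \<notin> I"
  proof
    assume "1 \<in> I"
    then have "{1, 2} \<subseteq> I \<inter> {1..2 * 1 + 1}" using pair(1)[of 1] n by auto
    then have "sum weight {1, 2} \<le> sum weight (I \<inter> {1..2 * 1 + 1})"
      using weight_pos by (intro sum_mono2) (auto intro: less_imp_le)
    also have "\<dots> \<le> budget 1" using desc[of 1] n by simp
    finally show False using weight_1_2 a_pos a_less_b by (simp add: budget_def)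
  qed
  have "x \<in> I \<longleftrightarrow> (\<exists>i. x = 2 * i \<and> i \<in> {1..n})" for x
  proof
    assume x: "x \<in> I"
    show "\<exists>i. x = 2 * i \<and> i \<in> {1..n}"
    proof (cases "even x")
      case True
      then show ?thesis using x I by (auto elim!: evenE)
    next
      case False
      then obtain k where "x = 2 * k + 1" by (auto elim!: oddE)
      then show ?thesis using x I \<open>1 \<notin> I\<close> pair(2)[of k] by (cases "k = 0") auto
    qed
  qed (use pair in auto)
  then show ?thesis by blast
qed

end

theorem proposition2p1:
  fixes n :: nat and a b :: real and v :: "nat \<Rightarrow> 'a" and w :: "'a \<Rightarrow> real"
  assumes "n \<ge> 2"
    and "inj_on v {1..2 * n + 1}"
    and "a > 0" and "b > 0"
    and "2 * b > 3 * a" and "2 * a > b" and "b > a"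
    and "\<forall>j \<in> {1, 2}. w (v j) = b"
    and "\<forall>i \<in> {1..n}. \<forall>j \<in> {2 * i, 2 * i + 1}. j \<ge> 3 \<longrightarrow> w (v j) = 2 ^ (i - 1) * a"
  shows "minimum_safe_set (path_graph v (2 * n + 1)) w {v (2 * i) | i. i \<in> {1..n}} \<and>
    (\<forall>S. minimum_safe_set (path_graph v (2 * n + 1)) w S \<longrightarrow> S = {v (2 * i) | i. i \<in> {1..n}})"
proof -
  interpret doubling_weights a b
    using assms by unfold_locales auto
  let ?m = "2 * n + 1"
  let ?G = "path_graph v ?m"
  define E where "E = (*) 2 ` {1..n}"
  have E: "E \<subseteq> {1..?m}" "E \<noteq> {}" unfolding E_def using assms(1) by auto
  have S: "{v (2 * i) | i. i \<in> {1..n}} = v ` E" unfolding E_def by blast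
  have w: "w (v j) = weight j" if "j \<in> {1..?m}" for j
  proof (cases "j \<le> 2")
    case True
    then have "j \<in> {1, 2}" using that by auto
    then show ?thesis using assms(8) True by (auto simp: weight_def)
  next
    case False
    then have "j div 2 \<in> {1..n}" "j \<in> {2 * (j div 2), 2 * (j div 2) + 1}" "3 \<le> j"
      using that by auto
    then have "w (v j) = 2 ^ (j div 2 - 1) * a" using assms(9) by blast
    then show ?thesis using False by (simp add: weight_def)
  qed
  have sum: "sum w (v ` I) = sum weight I" if "I \<subseteq> {1..?m}" for I
  proof -
    have "inj_on v I" using assms(2) that by (rule inj_on_subset)
    then show ?thesis using that w by (auto simp: sum.reindex intro!: sum.cong)
  qed
  have safe_iff: "safe_set ?G w (v ` I) \<longleftrightarrow> I \<noteq> {} \<and> path_safe weight ?m I" if "I \<subseteq> {1..?m}" for I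
    using safe_set_path_iff[OF assms(2) that] w by blast
  have safe_E: "safe_set ?G w (v ` E)"
    using safe_iff E path_safe_evens unfolding E_def by blast
  have w_E: "sum w (v ` E) = budget n"
    using sum[OF E(1)] sum_weight_evens assms(1) unfolding E_def by simp
  have light: "T = v ` E" if T: "safe_set ?G w T" "sum w T \<le> budget n" for T
  proof -
    have "T \<subseteq> v ` {1..?m}" using T(1) unfolding safe_set_def path_graph_simps by blast
    then obtain I where I: "I \<subseteq> {1..?m}" "T = v ` I" by (meson subset_imageE)
    then have "I = E"
      using T safe_iff sum light_safe_eq_evens[of n I] assms(1) unfolding E_def by simp
    then show ?thesis using I by simp
  qed
  have "minimum_safe_set ?G w (v ` E)"
    unfolding minimum_safe_set_def using safe_E light w_E by (metis linorder_le_cases)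
  moreover have "T = v ` E" if "minimum_safe_set ?G w T" for T
    using that safe_E w_E light unfolding minimum_safe_set_def by metis
  ultimately show ?thesis unfolding S by blast
qed

end
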